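(* Let $K\ge2$ be an integer, let $f_1,\dots,f_K$ be calibrators, and let $P_1,\dots,P_K,U$ be random variables, each uniformly distributed on $[0,1]$, such that $U$ is independent of $(P_1,\dots,P_K)$ (the joint distribution of $(P_1,\dots,P_K)$ being otherwise arbitrary). Then for each $\alpha\in(0,1)$ and each $(\lambda_1,\dots,\lambda_K)\in\Delta_K$, $$\mathbb P\left(\sum_{k=1}^K\lambda_k f_k\left(\frac{P_k}{\alpha}\right)\ge U\right)\le\alpha .$$ If moreover $f_1,\dots,f_K$ are admissible calibrators and $\mathbb P\left(\sum_{k=1}^K\lambda_kf_k(P_k/\alpha)\le1\right)=1$, then $$\mathbb P\left(\sum_{k=1}^K\lambda_k f_k\left(\frac{P_k}{\beta}\right)\ge U\right)=\beta\qquad\text{for all }\beta\in(0,\alpha].$$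
   Context: A calibrator is a decreasing (non-increasing) function $f:[0,\infty)\to[0,\infty]$ with $f=0$ on $(1,\infty)$ and $\int_0^1 f(p)\,\mathrm dp\le1$. It is admissible if it is upper semicontinuous, $f(0)=\infty$, and $\int_0^1f(p)\,\mathrm dp=1$. $\Delta_K=\{\lambda\in[0,1]^K:\sum_{k=1}^K\lambda_k=1\}$ is the standard simplex. *)

theory Defs
  imports "HOL-Probability.Probability"
begin

(* A calibrator is a function from [0,oo) to [0,oo].  Its domain is encoded in the usual
   extensional way: arguments below 0 are mapped to the fixed value undefined, so that the
   calibrators below are in bijection with the functions on [0,oo), and compositions with
   real random variables that are nonnegative only almost surely remain measurable. *)
definition calibrator :: "(real \<Rightarrow> ennreal) \<Rightarrow> bool" where
  "calibrator f \<longleftrightarrow>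
     f \<in> extensional {0..} \<and>
     antimono_on {0..} f \<and>
     (\<forall>p>1. f p = 0) \<and>
     (\<integral>\<^sup>+p\<in>{0..1}. f p \<partial>lborel) \<le> 1"

definition upper_semicontinuous_on ::
  "'a::topological_space set \<Rightarrow> ('a \<Rightarrow> 'b::linorder) \<Rightarrow> bool" where
  "upper_semicontinuous_on S f \<longleftrightarrow>
     (\<forall>x\<in>S. \<forall>a. f x < a \<longrightarrow> (\<forall>\<^sub>F y in at x within S. f y < a))"

definition admissible_calibrator :: "(real \<Rightarrow> ennreal) \<Rightarrow> bool" where
  "admissible_calibrator f \<longleftrightarrow>
     calibrator f \<and>
     upper_semicontinuous_on {0..} f \<and>
     f 0 = \<infinity> \<and>
     (\<integral>\<^sup>+p\<in>{0..1}. f p \<partial>lborel) = 1"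

definition uniform01 :: "'w measure \<Rightarrow> ('w \<Rightarrow> real) \<Rightarrow> bool" where
  "uniform01 M X \<longleftrightarrow>
     distributed M lborel X (\<lambda>x. indicator {0..1::real} x / measure lborel {0..1::real})"

(* Independence of two random variables with values in possibly different types; the constant
   indep_var only covers the case of a common type, where this is prob_space.indep_var_eq. *)
definition indep_rv ::
  "'w measure \<Rightarrow> 'a measure \<Rightarrow> ('w \<Rightarrow> 'a) \<Rightarrow> 'b measure \<Rightarrow> ('w \<Rightarrow> 'b) \<Rightarrow> bool" where
  "indep_rv M S X T Y \<longleftrightarrow>
     X \<in> measurable M S \<and> Y \<in> measurable M T \<and>
     prob_space.indep_set M
       (sigma_sets (space M) {X -` A \<inter> space M | A. A \<in> sets S})
       (sigma_sets (space M) {Y -` B \<inter> space M | B. B \<in> sets T})"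

(* Vectors indexed by 1..K; values of l outside the index range are irrelevant. *)
definition std_simplex :: "nat \<Rightarrow> (nat \<Rightarrow> real) set" where
  "std_simplex K = {l. (\<forall>k\<in>{1..K}. l k \<in> {0..1}) \<and> (\<Sum>k=1..K. l k) = 1}"

(* sum_k l_k f_k(p_k / a), computed in [0,oo] with the convention 0 * oo = 0 *)
definition calibrated_sum ::
  "nat \<Rightarrow> (nat \<Rightarrow> real \<Rightarrow> ennreal) \<Rightarrow> (nat \<Rightarrow> real) \<Rightarrow> (nat \<Rightarrow> real) \<Rightarrow> real \<Rightarrow> ennreal" where
  "calibrated_sum K f l p a = (\<Sum>k=1..K. ennreal (l k) * f k (p k / a))"

end

theory Submission
  imports Defs
begin

text \<open>Conditionally on the \<open>P\<^sub>k\<close>, the event \<open>U \<le> S\<close> for the independent uniform variable \<open>U\<close> has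
  probability \<open>min S 1\<close>, so \<open>\<P>(U \<le> S) = E (min S 1)\<close>. By linearity and a change of variables
  \<open>E S\<close> is \<open>\<alpha>\<close> times a convex combination of the integrals of the calibrators; no mass is lost
  in the substitution because \<open>\<alpha> < 1\<close> and calibrators vanish beyond \<open>1\<close>. Equality holds as
  soon as truncation at \<open>1\<close> is almost surely inactive, and monotonicity of the calibrators
  carries this from \<open>\<alpha>\<close> to every smaller \<open>\<beta>\<close>.\<close>

text \<open>On \<open>{c..}\<close> monotonicity makes every superlevel set an interval. Below
  \<open>c\<close> the function is the constant \<open>undefined\<close>, so that part of a
  superlevel set is either \<open>{..<c}\<close> or empty, whatever the value of
  \<open>undefined\<close>.\<close>

lemma borel_measurable_antimono_on_extensional:
  fixes f :: "real \<Rightarrow> 'a::{linorder_topology, second_countable_topology}"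
  assumes "f \<in> extensional {c..}" "antimono_on {c..} f"
  shows "f \<in> borel_measurable borel"
proof (rule borel_measurableI_greater)
  fix a
  have "is_interval {x. c \<le> x \<and> a < f x}"
    unfolding is_interval_1
  proof safe
    fix x y z assume "c \<le> x" "x \<le> z" "z \<le> y" "a < f y"
    moreover from this have "f y \<le> f z"
      using monotone_onD[OF assms(2), of z y] by simp
    ultimately show "a < f z"
      by order
  qed linarith
  then have "{x. c \<le> x \<and> a < f x} \<in> sets borel"
    by (rule real_interval_borel_measurable)
  moreover have "{x. x < c \<and> a < f x} = (if a < undefined then {..<c} else {})"
    using extensional_arb[OF assms(1)] by auto
  then have "{x. x < c \<and> a < f x} \<in> sets borel"
    by simp
  moreover have "{x \<in> space borel. a < f x} =
      {x. c \<le> x \<and> a < f x} \<union> {x. x < c \<and> a < f x}"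
    by auto
  ultimately show "{x \<in> space borel. a < f x} \<in> sets borel"
    by simp
qed

lemma borel_measurable_calibrator:
  "calibrator f \<Longrightarrow> f \<in> borel_measurable borel"
  unfolding calibrator_def by (blast intro: borel_measurable_antimono_on_extensional)

lemma nn_integral_uniform01:
  assumes "uniform01 M X" "g \<in> borel_measurable borel"
  shows "(\<integral>\<^sup>+\<omega>. g (X \<omega>) \<partial>M) = (\<integral>\<^sup>+x\<in>{0..1}. g x \<partial>lborel)"
  using distributed_nn_integral[OF assms(1)[unfolded uniform01_def], of g] assms(2)
  by (simp add: mult.commute ennreal_indicator)

lemma uniform01_measurable: "uniform01 M X \<Longrightarrow> X \<in> borel_measurable M"
  unfolding uniform01_def by (auto dest: distributed_measurable)

text \<open>The density fixes only the law, so single outcomes may leave the unit interval. This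
  null set is discarded twice below: to cap at 1 the quantity compared with \<open>U\<close>, and to
  have all \<open>P k\<close> in the range where calibrators decrease.\<close>

lemma AE_uniform01:
  assumes "uniform01 M X"
  shows "AE \<omega> in M. X \<omega> \<in> {0..1}"
proof -
  have [measurable]: "X \<in> borel_measurable M"
    using assms by (rule uniform01_measurable)
  have "(\<integral>\<^sup>+\<omega>. indicator (- {0..1}) (X \<omega>) \<partial>M) = 
      (\<integral>\<^sup>+x. indicator (- {0..1}) x * indicator {0..1::real} x \<partial>lborel)"
    by (rule nn_integral_uniform01[OF assms]) simp
  also have "\<dots> = (\<integral>\<^sup>+x. 0 \<partial>(lborel :: real measure))"
    by (rule nn_integral_cong) (simp split: split_indicator)
  finally have "(\<integral>\<^sup>+\<omega>. indicator (- {0..1}) (X \<omega>) \<partial>M) = 0"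
    by simp
  then have "AE \<omega> in M. (indicator (- {0..1}) (X \<omega>) :: ennreal) = 0"
    by (subst (asm) nn_integral_0_iff_AE) simp_all
  then show ?thesis
    by (auto split: split_indicator_asm)
qed

lemma emeasure_uniform01_atMost:
  assumes "uniform01 M X" "0 \<le> y" "y \<le> 1"
  shows "emeasure (distr M borel X) {..y} = ennreal y"
proof -
  have [measurable]: "X \<in> borel_measurable M"
    using assms(1) by (rule uniform01_measurable)
  have "emeasure (distr M borel X) {..y} = (\<integral>\<^sup>+\<omega>. indicator {..y} (X \<omega>) \<partial>M)"
    by (simp add: nn_integral_distr flip: nn_integral_indicator)
  also have "\<dots> = (\<integral>\<^sup>+x. indicator {..y} x * indicator {0..1} x \<partial>lborel)"
    by (rule nn_integral_uniform01[OF assms(1)]) simp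
  also have "\<dots> = (\<integral>\<^sup>+x. indicator {0..y} x \<partial>lborel)"
    using assms by (intro nn_integral_cong) (auto split: split_indicator)
  finally show ?thesis
    using assms by simp
qed

text \<open>The sigma-algebra generated by \<open>g\<close> after \<open>Y\<close> lies inside the
  one generated by \<open>Y\<close>, and independence passes to subfamilies. Since \<open>g\<close>
  maps into the space \<open>S\<close> of \<open>X\<close>, both variables now share a type and
  \<open>indep_var\<close> applies.\<close>

lemma (in prob_space) indep_rv_compose:
  assumes "indep_rv M S X T Y" "g \<in> measurable T S"
  shows "indep_var S X S (\<lambda>\<omega>. g (Y \<omega>))"
proof -
  have X: "X \<in> measurable M S" and Y: "Y \<in> measurable M T"
    and ind: "indep_set (sigma_sets (space M) {X -` A \<inter> space M | A. A \<in> sets S})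
       (sigma_sets (space M) {Y -` B \<inter> space M | B. B \<in> sets T})"
    using assms(1) by (auto simp: indep_rv_def)
  have "{(\<lambda>\<omega>. g (Y \<omega>)) -` A \<inter> space M | A. A \<in> sets S} \<subseteq>
      {Y -` B \<inter> space M | B. B \<in> sets T}"
  proof safe
    fix A assume "A \<in> sets S"
    then have "g -` A \<inter> space T \<in> sets T"
      using assms(2) by (rule measurable_sets[rotated])
    moreover have "(\<lambda>\<omega>. g (Y \<omega>)) -` A \<inter> space M = Y -` (g -` A \<inter> space T) \<inter> space M"
      using measurable_space[OF Y] by auto
    ultimately show "\<exists>B. (\<lambda>\<omega>. g (Y \<omega>)) -` A \<inter> space M = Y -` B \<inter> space M \<and> B \<in> sets T"
      by blast
  qed
  then have "sigma_sets (space M) {(\<lambda>\<omega>. g (Y \<omega>)) -` A \<inter> space M | A. A \<in> sets S} \<subseteq>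
      sigma_sets (space M) {Y -` B \<inter> space M | B. B \<in> sets T}"
    by (rule sigma_sets_mono')
  then have "indep_set (sigma_sets (space M) {X -` A \<inter> space M | A. A \<in> sets S})
      (sigma_sets (space M) {(\<lambda>\<omega>. g (Y \<omega>)) -` A \<inter> space M | A. A \<in> sets S})"
    using indep_setD_ev1[OF ind] indep_setD_ev2[OF ind]
    by (intro indep_setI indep_setD[OF ind]) (auto dest: subsetD)
  then show ?thesis
    using X measurable_compose[OF Y assms(2)] by (simp add: indep_var_eq)
qed

text \<open>Independence turns the joint law into a product, so the set below the diagonal can be
  measured slice by slice. The slice at height \<open>y\<close> is \<open>{..y}\<close>, which has
  mass \<open>y\<close> because \<open>Y\<close> takes values in the unit interval.\<close>

lemma (in prob_space) emeasure_uniform01_le_indep_var: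
  assumes U: "uniform01 M U" and ind: "indep_var borel U borel Y"
    and Y: "\<And>\<omega>. \<omega> \<in> space M \<Longrightarrow> Y \<omega> \<in> {0..1}"
  shows "emeasure M {\<omega> \<in> space M. U \<omega> \<le> Y \<omega>} = (\<integral>\<^sup>+\<omega>. ennreal (Y \<omega>) \<partial>M)"
proof -
  have [measurable]: "U \<in> borel_measurable M" "Y \<in> borel_measurable M"
    using ind by (auto dest: indep_var_rv1 indep_var_rv2)
  interpret DU: prob_space "distr M borel U" by (rule prob_space_distr) simp
  interpret DY: prob_space "distr M borel Y" by (rule prob_space_distr) simp
  interpret pair_sigma_finite "distr M borel U" "distr M borel Y" ..
  let ?A = "{z :: real \<times> real. fst z \<le> snd z}"
  have A: "?A \<in> sets (borel \<Otimes>\<^sub>M borel)"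
    unfolding borel_prod by (intro borel_closed closed_Collect_le continuous_intros)
  \<comment> \<open>The distribution function is increasing, so its superlevel sets are intervals.
    Its measurability is what allows pulling the integral over the law of \<open>Y\<close> back to
    \<open>M\<close>.\<close>
  have [measurable]: "(\<lambda>y. emeasure (distr M borel U) {..y}) \<in> borel_measurable borel"
    by (rule borel_measurableI_greater, rule real_interval_borel_measurable)
      (auto simp: is_interval_1 elim!: less_le_trans intro!: emeasure_mono)
  have "emeasure M {\<omega> \<in> space M. U \<omega> \<le> Y \<omega>} =
      emeasure (distr M (borel \<Otimes>\<^sub>M borel) (\<lambda>\<omega>. (U \<omega>, Y \<omega>))) ?A"
    using A by (subst emeasure_distr) (auto intro: arg_cong2[where f = emeasure])
  also have "\<dots> = emeasure (distr M borel U \<Otimes>\<^sub>M distr M borel Y) ?A"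
    using ind by (simp add: indep_var_distribution_eq)
  also have "\<dots> = (\<integral>\<^sup>+y. emeasure (distr M borel U) ((\<lambda>x. (x, y)) -` ?A) \<partial>distr M borel Y)"
    using A by (intro emeasure_pair_measure_alt2) (simp cong: sets_pair_measure_cong)
  also have "\<dots> = (\<integral>\<^sup>+y. emeasure (distr M borel U) {..y} \<partial>distr M borel Y)"
    by (simp add: vimage_def atMost_def)
  also have "\<dots> = (\<integral>\<^sup>+\<omega>. emeasure (distr M borel U) {..Y \<omega>} \<partial>M)"
    by (rule nn_integral_distr) simp_all
  also have "\<dots> = (\<integral>\<^sup>+\<omega>. ennreal (Y \<omega>) \<partial>M)"
    using Y by (intro nn_integral_cong emeasure_uniform01_atMost[OF U]) auto
  finally show ?thesis .
qed

text \<open>Since \<open>U\<close> is almost surely at most 1, capping \<open>g (X \<omega>)\<close>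
  at 1 changes the event only on a null set. The capped value is finite, hence a real number in the
  unit interval, and the real-valued case applies to it.\<close>

lemma (in prob_space) emeasure_uniform01_le_indep_rv:
  assumes U: "uniform01 M U" and ind: "indep_rv M borel U N X"
    and g[measurable]: "g \<in> borel_measurable N"
  shows "emeasure M {\<omega> \<in> space M. ennreal (U \<omega>) \<le> g (X \<omega>)} =
    (\<integral>\<^sup>+\<omega>. min (g (X \<omega>)) 1 \<partial>M)"
proof -
  have [measurable]: "X \<in> measurable M N" "U \<in> borel_measurable M"
    using ind by (auto simp: indep_rv_def)
  define Y where "Y \<omega> = enn2real (min (g (X \<omega>)) 1)" for \<omega>
  have fin: "min (g (X \<omega>)) 1 < top" for \<omega>
    by (simp add: min_less_iff_disj)
  have Y: "ennreal (Y \<omega>) = min (g (X \<omega>)) 1" for \<omega>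
    unfolding Y_def using fin by simp
  have Y1: "Y \<omega> \<in> {0..1}" for \<omega>
    unfolding Y_def by (auto intro: enn2real_leI)
  have [measurable]: "Y \<in> borel_measurable M"
    unfolding Y_def by simp
  have "indep_var borel U borel Y"
    unfolding Y_def using ind by (rule indep_rv_compose) simp
  then have *: "emeasure M {\<omega> \<in> space M. U \<omega> \<le> Y \<omega>} = (\<integral>\<^sup>+\<omega>. ennreal (Y \<omega>) \<partial>M)"
    using U Y1 by (intro emeasure_uniform01_le_indep_var) auto
  have "AE \<omega> in M. ennreal (U \<omega>) \<le> g (X \<omega>) \<longleftrightarrow> U \<omega> \<le> Y \<omega>"
    using AE_uniform01[OF U]
  proof eventually_elim
    case (elim \<omega>)
    then have "ennreal (U \<omega>) \<le> 1"
      by simp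
    then have "ennreal (U \<omega>) \<le> g (X \<omega>) \<longleftrightarrow> ennreal (U \<omega>) \<le> ennreal (Y \<omega>)"
      by (simp add: Y)
    \<comment> \<open>Because \<open>Y \<omega>\<close> is nonnegative, the comparison in
      \<open>ennreal\<close> is equivalent to the one between reals, even though
      \<open>ennreal\<close> sends negative numbers to 0.\<close>
    then show ?case
      using Y1[of \<omega>] by simp
  qed
  then have "emeasure M {\<omega> \<in> space M. ennreal (U \<omega>) \<le> g (X \<omega>)} =
      emeasure M {\<omega> \<in> space M. U \<omega> \<le> Y \<omega>}"
    by (intro emeasure_eq_AE) auto
  then show ?thesis
    by (simp add: * Y)
qed

text \<open>The substitution \<open>x = a * y\<close> contributes the factor \<open>a\<close> and
  stretches the domain from \<open>{0..1}\<close> to \<open>{0..1/a}\<close>. As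
  \<open>a \<le> 1\<close>, this still contains \<open>{0..1}\<close>, and the calibrator vanishes
  on the rest.\<close>

lemma nn_integral_calibrator_uniform01:
  assumes f: "calibrator f" and X: "uniform01 M X" and a: "0 < a" "a \<le> 1"
  shows "(\<integral>\<^sup>+\<omega>. f (X \<omega> / a) \<partial>M) = ennreal a * (\<integral>\<^sup>+x\<in>{0..1}. f x \<partial>lborel)"
proof -
  have [measurable]: "f \<in> borel_measurable borel"
    using f by (rule borel_measurable_calibrator)
  have "(\<integral>\<^sup>+\<omega>. f (X \<omega> / a) \<partial>M) = (\<integral>\<^sup>+x. f (x / a) * indicator {0..1} x \<partial>lborel)"
    by (rule nn_integral_uniform01[OF X]) simp
  also have "\<dots> = ennreal \<bar>a\<bar> *
      (\<integral>\<^sup>+x. f ((0 + a * x) / a) * indicator {0..1} (0 + a * x) \<partial>lborel)"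
    using a by (intro nn_integral_real_affine) simp_all
  also have "(\<integral>\<^sup>+x. f ((0 + a * x) / a) * indicator {0..1} (0 + a * x) \<partial>lborel) =
      (\<integral>\<^sup>+x\<in>{0..1}. f x \<partial>lborel)"
  proof (rule nn_integral_cong)
    fix x :: real
    have "f x = 0" if "1 < x"
      using f that by (simp add: calibrator_def)
    moreover have "0 \<le> a * x \<longleftrightarrow> 0 \<le> x"
      using a by (simp add: zero_le_mult_iff)
    moreover have "a * x \<le> 1" if "0 \<le> x" "x \<le> 1"
      using a that by (simp add: mult_le_one)
    ultimately show "f ((0 + a * x) / a) * indicator {0..1} (0 + a * x) =
        f x * indicator {0..1} x"
      using a by (cases "x \<le> 1") (auto split: split_indicator)
  qed
  finally show ?thesis
    using a by simp
qed

text \<open>By linearity each summand is integrated separately, so only the marginal laws of the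
  \<open>P k\<close> enter and their dependence may be arbitrary.\<close>

lemma nn_integral_calibrated_sum:
  assumes f: "\<And>k. k \<in> {1..K} \<Longrightarrow> calibrator (f k)"
    and P: "\<And>k. k \<in> {1..K} \<Longrightarrow> uniform01 M (P k)"
    and a: "0 < a" "a \<le> 1"
  shows "(\<integral>\<^sup>+\<omega>. calibrated_sum K f l (\<lambda>k. P k \<omega>) a \<partial>M) =
    ennreal a * (\<Sum>k=1..K. ennreal (l k) * (\<integral>\<^sup>+x\<in>{0..1}. f k x \<partial>lborel))"
proof -
  have [measurable]: "f k \<in> borel_measurable borel" "P k \<in> borel_measurable M"
    if "k \<in> {1..K}" for k
    using f P that by (auto intro: borel_measurable_calibrator uniform01_measurable)
  have "(\<integral>\<^sup>+\<omega>. calibrated_sum K f l (\<lambda>k. P k \<omega>) a \<partial>M) =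
      (\<Sum>k=1..K. (\<integral>\<^sup>+\<omega>. ennreal (l k) * f k (P k \<omega> / a) \<partial>M))"
    unfolding calibrated_sum_def by (intro nn_integral_sum) measurable
  also have "\<dots> = (\<Sum>k=1..K. ennreal (l k) * (\<integral>\<^sup>+\<omega>. f k (P k \<omega> / a) \<partial>M))"
    by (intro sum.cong refl nn_integral_cmult) measurable
  also have "\<dots> = (\<Sum>k=1..K. ennreal a * (ennreal (l k) * (\<integral>\<^sup>+x\<in>{0..1}. f k x \<partial>lborel)))"
    using f P a
    by (intro sum.cong refl) (simp add: nn_integral_calibrator_uniform01 mult.left_commute)
  finally show ?thesis
    by (simp add: sum_distrib_left)
qed

lemma sum_ennreal_std_simplex:
  assumes "l \<in> std_simplex K"
  shows "(\<Sum>k=1..K. ennreal (l k)) = 1"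
  using assms by (subst sum_ennreal) (auto simp: std_simplex_def)

text \<open>Shrinking the divisor moves each nonnegative argument \<open>p k / a\<close> to the
  right, where the decreasing \<open>f k\<close> is no larger.\<close>

lemma calibrated_sum_mono:
  assumes f: "\<And>k. k \<in> {1..K} \<Longrightarrow> calibrator (f k)"
    and p: "\<And>k. k \<in> {1..K} \<Longrightarrow> 0 \<le> p k" and b: "0 < b" "b \<le> a"
  shows "calibrated_sum K f l p b \<le> calibrated_sum K f l p a"
  unfolding calibrated_sum_def
proof (intro sum_mono mult_left_mono zero_le)
  fix k assume k: "k \<in> {1..K}"
  have "antimono_on {0..} (f k)"
    using f[OF k] by (simp add: calibrator_def)
  then show "f k (p k / b) \<le> f k (p k / a)"
    by (rule monotone_onD) (use p[OF k] b in \<open>auto intro: divide_left_mono\<close>)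
qed

theorem theorem3p11:
  fixes M :: "'w measure" and K :: nat
    and f :: "nat \<Rightarrow> real \<Rightarrow> ennreal"
    and P :: "nat \<Rightarrow> 'w \<Rightarrow> real" and U :: "'w \<Rightarrow> real"
    and \<alpha> :: real and l :: "nat \<Rightarrow> real"
  assumes "prob_space M"
    and "K \<ge> 2"
    and "\<And>k. k \<in> {1..K} \<Longrightarrow> calibrator (f k)"
    and "\<And>k. k \<in> {1..K} \<Longrightarrow> uniform01 M (P k)"
    and "uniform01 M U"
    and "indep_rv M borel U (PiM {1..K} (\<lambda>_. borel)) (\<lambda>\<omega>. \<lambda>k\<in>{1..K}. P k \<omega>)"
    and "0 < \<alpha>" and "\<alpha> < 1"
    and "l \<in> std_simplex K"
  shows "\<P>(\<omega> in M. calibrated_sum K f l (\<lambda>k. P k \<omega>) \<alpha> \<ge> ennreal (U \<omega>)) \<le> \<alpha> \<and>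
    ((\<forall>k\<in>{1..K}. admissible_calibrator (f k)) \<and>
       \<P>(\<omega> in M. calibrated_sum K f l (\<lambda>k. P k \<omega>) \<alpha> \<le> 1) = 1 \<longrightarrow>
     (\<forall>\<beta>\<in>{0<..\<alpha>}.
        \<P>(\<omega> in M. calibrated_sum K f l (\<lambda>k. P k \<omega>) \<beta> \<ge> ennreal (U \<omega>)) = \<beta>))"
proof -
  interpret prob_space M by fact
  note f = assms(3) and P = assms(4)
  have [measurable]: "f k \<in> borel_measurable borel" "P k \<in> borel_measurable M"
    if "k \<in> {1..K}" for k
    using f P that by (auto intro: borel_measurable_calibrator uniform01_measurable)
  let ?S = "\<lambda>a \<omega>. calibrated_sum K f l (\<lambda>k. P k \<omega>) a"
  have S[measurable]: "?S a \<in> borel_measurable M" for a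
    unfolding calibrated_sum_def by measurable
  have prob_eq: "emeasure M {\<omega> \<in> space M. ?S a \<omega> \<ge> ennreal (U \<omega>)} =
      (\<integral>\<^sup>+\<omega>. min (?S a \<omega>) 1 \<partial>M)" for a
  proof -
    let ?N = "PiM {1..K} (\<lambda>_. borel :: real measure)"
    have "(\<lambda>p. calibrated_sum K f l p a) \<in> borel_measurable ?N"
      unfolding calibrated_sum_def by measurable
    \<comment> \<open>Independence is assumed for the vector restricted to \<open>{1..K}\<close>;
      the sum reads no other coordinates, so it factors through that vector.\<close>
    moreover have "calibrated_sum K f l (\<lambda>k\<in>{1..K}. P k \<omega>) a = ?S a \<omega>" for \<omega>
      by (simp add: calibrated_sum_def)
    ultimately show ?thesis
      using emeasure_uniform01_le_indep_rv[OF assms(5,6), of "\<lambda>p. calibrated_sum K f l p a"]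
      by simp
  qed
  show ?thesis
  proof (intro conjI impI ballI)
    \<comment> \<open>Dropping the cap at 1 is one source of slack; the other is that the integral
      of a calibrator may be below 1.\<close>
    have "emeasure M {\<omega> \<in> space M. ?S \<alpha> \<omega> \<ge> ennreal (U \<omega>)} \<le> (\<integral>\<^sup>+\<omega>. ?S \<alpha> \<omega> \<partial>M)"
      unfolding prob_eq by (intro nn_integral_mono) simp
    also have "\<dots> =
        ennreal \<alpha> * (\<Sum>k=1..K. ennreal (l k) * (\<integral>\<^sup>+x\<in>{0..1}. f k x \<partial>lborel))"
      using f P assms(7,8) by (intro nn_integral_calibrated_sum) auto
    also have "\<dots> \<le> ennreal \<alpha> * (\<Sum>k=1..K. ennreal (l k) * 1)"
      using f by (intro mult_left_mono sum_mono) (auto simp: calibrator_def)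
    also have "\<dots> = ennreal \<alpha>"
      using sum_ennreal_std_simplex[OF assms(9)] by simp
    finally show "\<P>(\<omega> in M. ?S \<alpha> \<omega> \<ge> ennreal (U \<omega>)) \<le> \<alpha>"
      using assms(7) by (simp add: emeasure_eq_measure)
  next
    fix \<beta> assume \<beta>: "\<beta> \<in> {0<..\<alpha>}"
    assume adm: "(\<forall>k\<in>{1..K}. admissible_calibrator (f k)) \<and> \<P>(\<omega> in M. ?S \<alpha> \<omega> \<le> 1) = 1"
    have "AE \<omega> in M. ?S \<alpha> \<omega> \<le> 1"
      using adm by (subst prob_Collect_eq_1[symmetric]) auto
    moreover have "AE \<omega> in M. \<forall>k\<in>{1..K}. P k \<omega> \<in> {0..1}"
      using P by (intro AE_finite_allI AE_uniform01) auto
    \<comment> \<open>The bound by 1 passes pathwise from \<open>\<alpha>\<close> to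
      \<open>\<beta>\<close>, so the cap is inactive at \<open>\<beta>\<close> as well and the first
      source of slack disappears.\<close>
    ultimately have "AE \<omega> in M. min (?S \<beta> \<omega>) 1 = ?S \<beta> \<omega>"
    proof eventually_elim
      case (elim \<omega>)
      have "?S \<beta> \<omega> \<le> ?S \<alpha> \<omega>"
        using f elim \<beta> by (intro calibrated_sum_mono) auto
      with elim show ?case
        by (simp add: min_absorb1)
    qed
    then have "emeasure M {\<omega> \<in> space M. ?S \<beta> \<omega> \<ge> ennreal (U \<omega>)} = (\<integral>\<^sup>+\<omega>. ?S \<beta> \<omega> \<partial>M)"
      unfolding prob_eq by (rule nn_integral_cong_AE)
    also have "\<dots> =
        ennreal \<beta> * (\<Sum>k=1..K. ennreal (l k) * (\<integral>\<^sup>+x\<in>{0..1}. f k x \<partial>lborel))"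
      using f P \<beta> assms(8) by (intro nn_integral_calibrated_sum) auto
    \<comment> \<open>Admissibility removes the second source of slack: every integral equals 1,
      leaving only the weights.\<close>
    also have "(\<Sum>k=1..K. ennreal (l k) * (\<integral>\<^sup>+x\<in>{0..1}. f k x \<partial>lborel)) =
        (\<Sum>k=1..K. ennreal (l k))"
      using adm by (intro sum.cong) (auto simp: admissible_calibrator_def)
    also have "\<dots> = 1"
      using assms(9) by (rule sum_ennreal_std_simplex)
    finally show "\<P>(\<omega> in M. ?S \<beta> \<omega> \<ge> ennreal (U \<omega>)) = \<beta>"
      using \<beta> by (simp add: emeasure_eq_measure)
  qed
qed

end
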